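(* Let $e_1,\dots,e_k\in\mathbb{C}^{n\times n}$ be an anticommuting family and let $r:=\min_{i\in[k]}\mathrm{rk}(e_i^2)$. (1) If $r>n(1-1/c)$ for some positive integer $c$, then $k\le c\,n^{2/c}$. (2) If $r> n\left(1-\frac{1}{2(\log_2 n+1)}\right)$, then $k\le 2\log_2 n+1$.
   Context: A family $e_1,\dots,e_k$ of complex $n\times n$ matrices is called anticommuting if $e_ie_j=-e_je_i$ for all distinct $i,j\in[k]=\{1,\dots,k\}$. $\mathrm{rk}$ denotes matrix rank. *)

theory Defs
  imports "HOL-Analysis.Analysis"
begin

text \<open>A family e_0,...,e_(k-1) of complex n x n matrices (n = CARD('n)) is anticommuting
  if e_i e_j = - e_j e_i for all distinct indices i, j.\<close>
definition anticommuting :: "nat \<Rightarrow> (nat \<Rightarrow> complex^'n^'n) \<Rightarrow> bool" where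
  "anticommuting k e \<longleftrightarrow> (\<forall>i<k. \<forall>j<k. i \<noteq> j \<longrightarrow> e i ** e j = - (e j ** e i))"

end

theory Submission
  imports Defs
begin

text \<open>
  For S \<subseteq> {0..<k} let e_S be the product of the e_i, i \<in> S, in increasing order.
  Anticommutation gives e_S^2 = \<plusminus> \<Prod>(i \<in> S) e_i^2, and Sylvester's rank inequality bounds
  the rank of that product from below by n - |S|(n - r), so e_S^2 \<noteq> 0 whenever |S|(n - r) < n.
  The e_S of such sets S, all of one parity, are linearly independent: given \<Sum> a_S e_S = 0, pick
  T of maximal size with a_T \<noteq> 0 and apply, for each t \<in> T, a signed commutator
  X \<mapsto> e_t X \<plusminus> X e_t.  With the right signs it kills every e_S X with t \<notin> S and doubles the
  others up to sign, so only a nonzero multiple of e_T^2 survives.  Hence such a family has at most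
  n^2 members.  All c-subsets give (k/c)^c \<le> (k choose c) \<le> n^2, which is (1); all subsets of an
  m-set, split by parity, give 2^m \<le> 2 n^2 for every m \<le> k with m (n - r) < n, which is (2).
\<close>

section \<open>Linear algebra over an arbitrary field\<close>

lemma (in finite_dimensional_vector_space) independent_Un_span_Int:
  assumes indep: "independent (B \<union> C)" and disjoint: "B \<inter> C = {}"
  shows "span B \<inter> span C = {0}"
proof -
  have "finite B" "finite C" using finiteI_independent[OF indep] by auto
  moreover have "independent B" "independent C" using independent_mono[OF indep] by auto
  moreover have "dim (span (B \<union> C)) + dim (span B \<inter> span C) = dim (span B) + dim (span C)"
    unfolding span_Un by (rule dim_sums_Int) auto
  ultimately have "dim (span B \<inter> span C) = 0"
    using indep disjoint by (simp add: dim_eq_card_independent card_Un_disjoint)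
  then show ?thesis by (auto simp: span_zero)
qed

lemma dim_image_add_dim_kernel:
  fixes f :: "'a::field^'n \<Rightarrow> 'a^'m"
  assumes lin: "Vector_Spaces.linear (*s) (*s) f" and V: "vec.subspace V"
  shows "vec.dim (f ` V) + vec.dim {x\<in>V. f x = 0} = vec.dim V"
proof -
  interpret f: Vector_Spaces.linear "(*s)" "(*s)" f by (rule lin)
  let ?K = "{x\<in>V. f x = 0}"
  obtain B0 where B0: "B0 \<subseteq> ?K" "vec.independent B0" "?K \<subseteq> vec.span B0" "card B0 = vec.dim ?K"
    using vec.basis_exists by blast
  obtain B where B: "B0 \<subseteq> B" "B \<subseteq> V" "vec.independent B" "V \<subseteq> vec.span B"
    using vec.maximal_independent_subset_extend[of B0 V] B0 by blast
  define C where "C = B - B0"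
  have B_split: "B = B0 \<union> C" "B0 \<inter> C = {}" using B(1) C_def by auto
  have span_B: "vec.span B = V" using vec.span_subspace[OF B(2) B(4) V] .
  have "inj_on f (vec.span C)"
  proof (rule f.inj_on_iff_eq_0[THEN iffD2, OF vec.subspace_span], intro ballI impI)
    fix x assume x: "x \<in> vec.span C" "f x = 0"
    then have "x \<in> V" using span_B B_split vec.span_mono[of C B] by auto
    with x B0(3) have "x \<in> vec.span B0 \<inter> vec.span C" by auto
    then show "x = 0" using vec.independent_Un_span_Int[of B0 C] B(3) B_split by auto
  qed
  moreover have "finite_dimensional_vector_space_pair_1 (*s) (cart_basis :: ('a^'n) set)
      ((*s) :: 'a \<Rightarrow> 'a^'m \<Rightarrow> 'a^'m)"
    by unfold_locales
  ultimately have dim_image_C: "vec.dim (f ` C) = vec.dim C"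
    using finite_dimensional_vector_space_pair_1.dim_image_eq[OF _ lin] by blast
  have "vec.span (f ` B) = vec.span (f ` C)"
  proof (rule antisym)
    have "f ` B \<subseteq> insert 0 (f ` C)" using B0(1) B_split by auto
    then show "vec.span (f ` B) \<subseteq> vec.span (f ` C)"
      by (metis vec.span_insert_0 vec.span_mono)
    show "vec.span (f ` C) \<subseteq> vec.span (f ` B)"
      using B_split by (intro vec.span_mono) auto
  qed
  then have "vec.dim (f ` V) = card C"
    using dim_image_C vec.dim_eq_card_independent vec.independent_mono[OF B(3)] C_def
    by (metis Diff_subset span_B f.span_image vec.dim_span)
  moreover have "vec.dim V = card B0 + card C"
    using vec.dim_span_eq_card_independent[OF B(3)] vec.finiteI_independent[OF B(3)] B_split span_B
    by (simp del: vec.dim_span add: card_Un_disjoint)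
  ultimately show ?thesis using B0(4) by simp
qed

lemma card_le_CARD_if_scalars_zero:
  fixes f :: "'b \<Rightarrow> 'a::field^'n"
  assumes fin: "finite F" and scalars_zero: "\<And>a. (\<Sum>x\<in>F. a x *s f x) = 0 \<Longrightarrow> \<forall>x\<in>F. a x = 0"
  shows "card F \<le> CARD('n)"
proof -
  have inj: "inj_on f F"
  proof (rule inj_onI, rule ccontr)
    fix x y assume xy: "x \<in> F" "y \<in> F" "f x = f y" "x \<noteq> y"
    define a :: "'b \<Rightarrow> 'a" where "a z = (if z = x then 1 else if z = y then -1 else 0)" for z
    have "(\<Sum>z\<in>F. a z *s f z) = (\<Sum>z\<in>{x, y}. a z *s f z)"
      using fin xy by (intro sum.mono_neutral_right) (auto simp: a_def)
    also have "\<dots> = 0" using xy by (simp add: a_def vector_sneg_minus1[symmetric])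
    finally have "a x = 0" using scalars_zero xy(1) by blast
    then show False by (simp add: a_def)
  qed
  have "vec.independent (f ` F)"
  proof (rule vec.independent_if_scalars_zero)
    fix c v assume "(\<Sum>v\<in>f ` F. c v *s v) = 0" "v \<in> f ` F"
    then show "c v = 0" using scalars_zero[of "c \<circ> f"] by (auto simp: sum.reindex[OF inj])
  qed (use fin in simp)
  then have "card (f ` F) \<le> CARD('n)"
    using vec.independent_bound_general dim_subset_UNIV_cart_gen order_trans by blast
  with inj show ?thesis by (simp add: card_image)
qed

section \<open>Matrices\<close>

lemma linear_vector_matrix_mult: "Vector_Spaces.linear (*s) (*s) (\<lambda>x. x v* (A::'a::field^'n^'m))"
proof -
  have "(\<lambda>x. x v* A) = (*v) (transpose A)" by (simp add: fun_eq_iff)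
  then show ?thesis using matrix_vector_mul_linear_gen by metis
qed

lemma rank_eq_dim_range_vector_matrix_mult:
  fixes A :: "'a::field^'n^'m"
  shows "rank A = vec.dim (range (\<lambda>x. x v* A))"
proof -
  have row: "row i A = axis i 1 v* A" for i
    by (simp add: vec_eq_iff vector_matrix_mult_def axis_def row_def if_distrib if_distribR
        sum.delta cong: if_cong)
  have combination: "x v* A = (\<Sum>i\<in>UNIV. x$i *s row i A)" for x
    by (simp add: vec_eq_iff vector_matrix_mult_def row_def sum_component)
  have "rows A \<subseteq> vec.span (range (\<lambda>x. x v* A))"
    using row by (auto simp: rows_def intro!: vec.span_base)
  moreover have "x v* A \<in> vec.span (rows A)" for x
    unfolding combination
    by (intro vec.span_sum vec.span_scale vec.span_base) (auto simp: rows_def)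
  ultimately have "vec.span (rows A) = vec.span (range (\<lambda>x. x v* A))"
    by (auto simp: vec.span_eq)
  then show ?thesis unfolding row_rank_def_gen by (metis vec.dim_span)
qed

lemma rank_bound_gen: "rank (A::'a::field^'n^'m) \<le> CARD('n)"
  unfolding row_rank_def_gen by (rule dim_subset_UNIV_cart_gen)

lemma rank_I_gen: "rank (mat 1::'a::field^'n^'n) = CARD('n)"
proof -
  have "range (\<lambda>x::'a^'n. x v* mat 1) = UNIV" by simp
  then show ?thesis by (simp add: rank_eq_dim_range_vector_matrix_mult card_cart_basis)
qed

lemma rank_0_gen: "rank (0::'a::field^'n^'m) = 0"
proof -
  have "range (\<lambda>x. x v* (0::'a^'n^'m)) = {0}" by auto
  then show ?thesis by (simp add: rank_eq_dim_range_vector_matrix_mult)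
qed

lemma sylvester_rank_inequality:
  fixes A :: "'a::field^'n^'m" and B :: "'a::field^'p^'n"
  shows "rank A + rank B \<le> rank (A ** B) + CARD('n)"
proof -
  let ?f = "\<lambda>x. x v* A" and ?g = "\<lambda>y. y v* B"
  let ?ker_g = "\<lambda>V. {x\<in>V. ?g x = 0}"
  have "range (\<lambda>x. x v* (A ** B)) = ?g ` range ?f"
    by (auto simp: vector_matrix_mul_assoc[symmetric])
  then have AB: "rank (A ** B) = vec.dim (?g ` range ?f)"
    by (simp add: rank_eq_dim_range_vector_matrix_mult)
  interpret f: Vector_Spaces.linear "(*s)" "(*s)" ?f by (rule linear_vector_matrix_mult)
  have "vec.subspace (range ?f)" by (rule f.subspace_image[OF vec.subspace_UNIV])
  from dim_image_add_dim_kernel[OF linear_vector_matrix_mult this]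
  have "vec.dim (?g ` range ?f) + vec.dim (?ker_g (range ?f)) = rank A"
    by (simp add: rank_eq_dim_range_vector_matrix_mult)
  moreover have "rank B + vec.dim (?ker_g UNIV) = CARD('n)"
    using dim_image_add_dim_kernel[OF linear_vector_matrix_mult vec.subspace_UNIV]
    by (simp add: rank_eq_dim_range_vector_matrix_mult card_cart_basis)
  moreover have "vec.dim (?ker_g (range ?f)) \<le> vec.dim (?ker_g UNIV)"
    by (rule vec.dim_subset) auto
  ultimately show ?thesis using AB by linarith
qed

definition scale_matrix :: "'a::comm_ring_1 \<Rightarrow> 'a^'n^'m \<Rightarrow> 'a^'n^'m" where
  "scale_matrix c A = (\<chi> i j. c * A$i$j)"

lemma scale_matrix_mult_left: "scale_matrix c A ** B = scale_matrix c (A ** B)"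
  by (simp add: scale_matrix_def vec_eq_iff matrix_matrix_mult_def sum_distrib_left mult.assoc)

lemma scale_matrix_mult_right: "A ** scale_matrix c B = scale_matrix c (A ** B)"
  by (simp add: scale_matrix_def vec_eq_iff matrix_matrix_mult_def sum_distrib_left mult_ac)

lemma scale_matrix_scale_matrix [simp]: "scale_matrix c (scale_matrix d A) = scale_matrix (c * d) A"
  by (simp add: scale_matrix_def vec_eq_iff mult.assoc)

lemma scale_matrix_1 [simp]: "scale_matrix 1 A = A"
  and scale_matrix_0 [simp]: "scale_matrix 0 A = 0"
  and scale_matrix_zero [simp]: "scale_matrix c 0 = 0"
  and scale_matrix_minus_1: "scale_matrix (-1) A = - A"
  by (simp_all add: scale_matrix_def vec_eq_iff)

lemma scale_matrix_diff_left: "scale_matrix c A - scale_matrix d A = scale_matrix (c - d) A"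
  and scale_matrix_diff_right: "scale_matrix c (A - B) = scale_matrix c A - scale_matrix c B"
  by (simp_all add: scale_matrix_def vec_eq_iff algebra_simps)

lemma scale_matrix_sum: "scale_matrix c (\<Sum>x\<in>F. A x) = (\<Sum>x\<in>F. scale_matrix c (A x))"
  by (simp add: scale_matrix_def vec_eq_iff sum_distrib_left sum_component)

lemma scale_matrix_eq_0_iff: "scale_matrix (c::'a::idom) A = 0 \<longleftrightarrow> c = 0 \<or> A = 0"
  by (auto simp: scale_matrix_def vec_eq_iff)

lemma matrix_sum_distrib_right: "(\<Sum>x\<in>F. A x) ** B = (\<Sum>x\<in>F. A x ** B)"
  unfolding matrix_matrix_mult_def vec_eq_iff
  by (auto simp: sum_component sum_distrib_right intro: sum.swap)

lemma matrix_sum_distrib_left: "A ** (\<Sum>x\<in>F. B x) = (\<Sum>x\<in>F. A ** B x)"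
  by (induction F rule: infinite_finite_induct) (simp_all add: matrix_add_ldistrib)

definition flatten :: "'a^'n^'m \<Rightarrow> 'a^('m \<times> 'n)" where
  "flatten A = (\<chi> ij. A $ fst ij $ snd ij)"

lemma flatten_eq_0_iff: "flatten A = 0 \<longleftrightarrow> A = 0"
  by (auto simp: flatten_def vec_eq_iff)

lemma sum_scale_flatten:
  "(\<Sum>x\<in>F. a x *s flatten (A x)) = flatten (\<Sum>x\<in>F. scale_matrix (a x) (A x))"
  by (simp add: flatten_def scale_matrix_def vec_eq_iff sum_component)

fun matrix_word :: "(nat \<Rightarrow> 'a::semiring_1^'n^'n) \<Rightarrow> nat list \<Rightarrow> 'a^'n^'n" where
  "matrix_word A [] = mat 1"
| "matrix_word A (t # ts) = A t ** matrix_word A ts"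

lemma rank_matrix_word_ge:
  fixes A :: "nat \<Rightarrow> 'a::field^'n^'n"
  shows "CARD('n) \<le> rank (matrix_word A ts) + (\<Sum>t\<leftarrow>ts. CARD('n) - rank (A t))"
proof (induction ts)
  case Nil
  show ?case by (simp add: rank_I_gen)
next
  case (Cons t ts)
  have "rank (A t) + rank (matrix_word A ts) \<le> rank (matrix_word A (t # ts)) + CARD('n)"
    by (simp add: sylvester_rank_inequality)
  with Cons.IH rank_bound_gen[of "A t"] show ?case by simp
qed

section \<open>Monomials in an anticommuting family\<close>

definition monomial :: "(nat \<Rightarrow> 'a::semiring_1^'n^'n) \<Rightarrow> nat set \<Rightarrow> 'a^'n^'n" where
  "monomial e S = matrix_word e (sorted_list_of_set S)"

lemma anticommuting_word_commute:
  assumes anti: "anticommuting k e" and j: "j < k" and ts: "set ts \<subseteq> {..<k}" "distinct ts"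
  shows "e j ** matrix_word e ts
    = scale_matrix ((-1) ^ (length ts + of_bool (j \<in> set ts))) (matrix_word e ts ** e j)"
  using ts
proof (induction ts)
  case Nil
  then show ?case by simp
next
  case (Cons t ts)
  have swap: "e j ** e t = scale_matrix ((-1) ^ of_bool (t \<noteq> j)) (e t ** e j)"
  proof (cases "t = j")
    case False
    moreover have "t < k" using Cons.prems(1) by simp
    ultimately have "e j ** e t = - (e t ** e j)"
      using anti j unfolding anticommuting_def by blast
    with False show ?thesis by (simp add: scale_matrix_minus_1)
  qed simp
  have "e j ** matrix_word e (t # ts) = (e j ** e t) ** matrix_word e ts"
    by (simp add: matrix_mul_assoc)
  also have "\<dots> = scale_matrix ((-1) ^ of_bool (t \<noteq> j)) (e t ** (e j ** matrix_word e ts))"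
    by (simp add: swap scale_matrix_mult_left matrix_mul_assoc)
  also have "\<dots> = scale_matrix ((-1) ^ (of_bool (t \<noteq> j) + length ts + of_bool (j \<in> set ts)))
      (matrix_word e (t # ts) ** e j)"
    using Cons by (simp add: scale_matrix_mult_right matrix_mul_assoc power_add)
  also have "(-1::complex) ^ (of_bool (t \<noteq> j) + length ts + of_bool (j \<in> set ts))
      = (-1) ^ (length (t # ts) + of_bool (j \<in> set (t # ts)))"
    using Cons.prems(2) by (cases "t = j") (auto simp: power_add)
  finally show ?case .
qed

lemma anticommuting_monomial_commute:
  assumes anti: "anticommuting k e" and t: "t < k" and S: "S \<subseteq> {..<k}"
  shows "e t ** monomial e S = scale_matrix ((-1) ^ (card S + of_bool (t \<in> S))) (monomial e S ** e t)"
proof -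
  have "finite S" using S finite_subset by blast
  with anticommuting_word_commute[OF anti t, of "sorted_list_of_set S"] S show ?thesis
    by (simp add: monomial_def)
qed

lemma anticommuting_word_square:
  assumes anti: "anticommuting k e" and ts: "set ts \<subseteq> {..<k}" "distinct ts"
  shows "\<exists>m. matrix_word e ts ** matrix_word e ts
    = scale_matrix ((-1) ^ m) (matrix_word (\<lambda>t. e t ** e t) ts)"
  using ts
proof (induction ts)
  case Nil
  show ?case by (rule exI[of _ 0]) simp
next
  case (Cons t ts)
  then obtain m where m: "matrix_word e ts ** matrix_word e ts
      = scale_matrix ((-1) ^ m) (matrix_word (\<lambda>t. e t ** e t) ts)"
    by auto
  have swap: "matrix_word e ts ** e t = scale_matrix ((-1) ^ length ts) (e t ** matrix_word e ts)"
    using anticommuting_word_commute[OF anti, of t ts] Cons.prems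
    by (simp add: power_add[symmetric])
  have "matrix_word e (t # ts) ** matrix_word e (t # ts)
      = e t ** ((matrix_word e ts ** e t) ** matrix_word e ts)"
    by (simp add: matrix_mul_assoc)
  also have "\<dots> = scale_matrix ((-1) ^ length ts) ((e t ** e t) ** (matrix_word e ts ** matrix_word e ts))"
    by (simp add: swap scale_matrix_mult_left scale_matrix_mult_right matrix_mul_assoc)
  also have "\<dots> = scale_matrix ((-1) ^ (length ts + m)) (matrix_word (\<lambda>t. e t ** e t) (t # ts))"
    by (simp add: m scale_matrix_mult_right power_add)
  finally show ?case by blast
qed

definition twisted_commutator :: "'a::comm_ring_1 \<Rightarrow> 'a^'n^'n \<Rightarrow> 'a^'n^'n \<Rightarrow> 'a^'n^'n" where
  "twisted_commutator \<sigma> A X = A ** X - scale_matrix \<sigma> (X ** A)"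

(* For t \<notin> S with card S of parity p, and X a product of length ts generators other than e t,
   e t ** (monomial e S ** X) = (-1) ^ (p + length ts) * ((monomial e S ** X) ** e t).  Each step
   therefore kills the monomials avoiding t and doubles the others up to sign. *)
fun iterated_twisted_commutator ::
  "(nat \<Rightarrow> 'a::comm_ring_1^'n^'n) \<Rightarrow> nat \<Rightarrow> nat list \<Rightarrow> 'a^'n^'n \<Rightarrow> 'a^'n^'n" where
  "iterated_twisted_commutator e p [] X = X"
| "iterated_twisted_commutator e p (t # ts) X =
    twisted_commutator ((-1) ^ (p + length ts)) (e t) (iterated_twisted_commutator e p ts X)"

lemma iterated_twisted_commutator_0 [simp]: "iterated_twisted_commutator e p ts 0 = 0"
  by (induction ts) (simp_all add: twisted_commutator_def)

lemma iterated_twisted_commutator_sum: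
  "iterated_twisted_commutator e p ts (\<Sum>x\<in>F. scale_matrix (a x) (X x))
    = (\<Sum>x\<in>F. scale_matrix (a x) (iterated_twisted_commutator e p ts (X x)))"
proof (induction ts)
  case (Cons t ts)
  have "twisted_commutator \<sigma> A (\<Sum>x\<in>F. scale_matrix (a x) (Y x))
      = (\<Sum>x\<in>F. scale_matrix (a x) (twisted_commutator \<sigma> A (Y x)))" for \<sigma> A Y
    by (simp add: twisted_commutator_def matrix_sum_distrib_left matrix_sum_distrib_right scale_matrix_sum
        sum_subtractf scale_matrix_mult_left scale_matrix_mult_right scale_matrix_diff_right
        mult.commute)
  with Cons.IH show ?case by simp
qed simp

lemma iterated_twisted_commutator_monomial:
  assumes anti: "anticommuting k e" and S: "S \<subseteq> {..<k}" "even (card S) = even p"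
    and ts: "set ts \<subseteq> {..<k}" "distinct ts"
  shows "iterated_twisted_commutator e p ts (monomial e S) =
    (if set ts \<subseteq> S then scale_matrix ((-2 * (-1) ^ p) ^ length ts) (monomial e S ** matrix_word e ts)
     else 0)"
  using ts
proof (induction ts)
  case Nil
  then show ?case by (simp add: monomial_def)
next
  case (Cons t ts)
  show ?case
  proof (cases "set ts \<subseteq> S")
    case False
    with Cons show ?thesis by (simp add: twisted_commutator_def)
  next
    case True
    let ?Z = "monomial e S ** matrix_word e (t # ts)"
    have t: "t < k" "t \<notin> set ts" using Cons.prems by auto
    have "(-1::complex) ^ card S = (-1) ^ p" using S(2) by (simp add: minus_one_power_iff)
    with anticommuting_monomial_commute[OF anti t(1) S(1)]
    have left: "e t ** (monomial e S ** matrix_word e ts) = scale_matrix ((-1) ^ (p + of_bool (t \<in> S))) ?Z"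
      by (simp add: matrix_mul_assoc scale_matrix_mult_left power_add)
    have "matrix_word e ts ** e t = scale_matrix ((-1) ^ length ts) (e t ** matrix_word e ts)"
      using anticommuting_word_commute[OF anti t(1), of ts] Cons.prems t(2)
      by (simp add: power_add[symmetric])
    then have right: "(monomial e S ** matrix_word e ts) ** e t = scale_matrix ((-1) ^ length ts) ?Z"
      by (simp add: matrix_mul_assoc[symmetric] scale_matrix_mult_right)
    have sign: "(-1::complex) ^ (p + of_bool (t \<in> S)) - (-1) ^ (p + length ts) * (-1) ^ length ts
      = (if t \<in> S then -2 * (-1) ^ p else 0)"
      by (simp add: power_add mult.assoc flip: power_mult_distrib)
    have "iterated_twisted_commutator e p (t # ts) (monomial e S)
      = scale_matrix ((-2 * (-1) ^ p) ^ length ts * ((-1) ^ (p + of_bool (t \<in> S))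
          - (-1) ^ (p + length ts) * (-1) ^ length ts)) ?Z"
      using True Cons.IH Cons.prems
      by (simp add: twisted_commutator_def scale_matrix_mult_right scale_matrix_mult_left
          left right scale_matrix_diff_left scale_matrix_diff_right algebra_simps)
    also have "(-2 * (-1) ^ p :: complex) ^ length ts * ((-1) ^ (p + of_bool (t \<in> S))
          - (-1) ^ (p + length ts) * (-1) ^ length ts)
        = (if t \<in> S then (-2 * (-1) ^ p) ^ length (t # ts) else 0)"
      unfolding sign by simp
    finally show ?thesis using True by simp
  qed
qed

lemma iterated_twisted_commutator_isolates_monomial:
  assumes anti: "anticommuting k e" and F: "F \<subseteq> Pow {..<k}"
    and parity: "\<forall>S\<in>F. even (card S) = even p"
    and T: "T \<in> F" and maximal: "\<And>S. S \<in> F \<Longrightarrow> a S \<noteq> 0 \<Longrightarrow> T \<subseteq> S \<Longrightarrow> S = T"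
  shows "iterated_twisted_commutator e p (sorted_list_of_set T) (\<Sum>S\<in>F. scale_matrix (a S) (monomial e S))
    = scale_matrix (a T * (-2 * (-1) ^ p) ^ card T) (monomial e T ** monomial e T)"
proof -
  let ?ts = "sorted_list_of_set T"
  have fin: "finite F" "finite T"
    using F T by (auto intro: finite_subset[of _ "Pow {..<k}"] finite_subset[of _ "{..<k}"])
  have summand: "scale_matrix (a S) (iterated_twisted_commutator e p ?ts (monomial e S))
      = (if S = T then scale_matrix (a T * (-2 * (-1) ^ p) ^ card T) (monomial e T ** monomial e T) else 0)"
    if "S \<in> F" for S
  proof -
    have "iterated_twisted_commutator e p ?ts (monomial e S)
        = (if set ?ts \<subseteq> S then scale_matrix ((-2 * (-1) ^ p) ^ length ?ts) (monomial e S ** matrix_word e ?ts)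
           else 0)"
      by (rule iterated_twisted_commutator_monomial[OF anti]) (use parity that F T fin(2) in auto)
    then have image: "iterated_twisted_commutator e p ?ts (monomial e S)
        = (if T \<subseteq> S then scale_matrix ((-2 * (-1) ^ p) ^ card T) (monomial e S ** monomial e T) else 0)"
      using fin(2) by (simp add: monomial_def[of e T, symmetric])
    show ?thesis
    proof (cases "S = T")
      case False
      then have "a S = 0 \<or> \<not> T \<subseteq> S" using maximal \<open>S \<in> F\<close> by blast
      with False show ?thesis by (auto simp: image)
    qed (use image in simp)
  qed
  show ?thesis
    using fin(1) T
    by (simp add: iterated_twisted_commutator_sum summand sum.delta' cong: sum.cong)
qed

lemma anticommuting_monomials_independent:
  fixes p :: nat
  assumes anti: "anticommuting k e" and F: "F \<subseteq> Pow {..<k}"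
    and parity: "\<forall>S\<in>F. even (card S) = even p"
    and squares: "\<forall>S\<in>F. matrix_word (\<lambda>t. e t ** e t) (sorted_list_of_set S) \<noteq> 0"
    and combination: "(\<Sum>S\<in>F. scale_matrix (a S) (monomial e S)) = 0"
  shows "\<forall>S\<in>F. a S = 0"
proof (rule ccontr)
  assume "\<not> (\<forall>S\<in>F. a S = 0)"
  moreover have "card S < Suc k" if "S \<in> F" for S
    using that F card_mono[of "{..<k}" S] by auto
  ultimately obtain T where T: "T \<in> F" "a T \<noteq> 0"
    and largest: "\<forall>S. S \<in> F \<and> a S \<noteq> 0 \<longrightarrow> card S \<le> card T"
    using ex_has_greatest_nat[of "\<lambda>S. S \<in> F \<and> a S \<noteq> 0" _ card "Suc k"] by blast
  have "S = T" if "S \<in> F" "a S \<noteq> 0" "T \<subseteq> S" for S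
  proof -
    have "finite S" using that(1) F finite_subset by auto
    moreover have "card S \<le> card T" using largest that by blast
    ultimately show "S = T" using card_seteq[OF _ that(3)] by simp
  qed
  from iterated_twisted_commutator_isolates_monomial[OF anti F parity T(1), where a = a, OF this] combination
  have "scale_matrix (a T * (-2 * (-1) ^ p) ^ card T) (monomial e T ** monomial e T) = 0"
    by simp
  moreover have "finite T" using T(1) F finite_subset by auto
  then obtain m where "monomial e T ** monomial e T
      = scale_matrix ((-1) ^ m) (matrix_word (\<lambda>t. e t ** e t) (sorted_list_of_set T))"
    using anticommuting_word_square[OF anti, of "sorted_list_of_set T"] T(1) F
    by (auto simp: monomial_def)
  ultimately show False
    using squares T by (simp add: scale_matrix_eq_0_iff)
qed

lemma card_anticommuting_family_le:
  fixes e :: "nat \<Rightarrow> complex^'n^'n" and p d :: nat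
  assumes anti: "anticommuting k e" and F: "F \<subseteq> Pow {..<k}"
    and parity: "\<forall>S\<in>F. even (card S) = even p"
    and deficiency: "\<And>i. i < k \<Longrightarrow> CARD('n) \<le> rank (e i ** e i) + d"
    and small: "\<And>S. S \<in> F \<Longrightarrow> card S * d < CARD('n)"
  shows "card F \<le> CARD('n) ^ 2"
proof -
  have fin: "finite F" using F finite_subset by (auto intro: finite_subset[of _ "Pow {..<k}"])
  have "matrix_word (\<lambda>t. e t ** e t) (sorted_list_of_set S) \<noteq> 0" if S: "S \<in> F" for S
  proof
    have finS: "finite S" using S F finite_subset by auto
    assume "matrix_word (\<lambda>t. e t ** e t) (sorted_list_of_set S) = 0"
    then have "CARD('n) \<le> (\<Sum>t\<in>S. CARD('n) - rank (e t ** e t))"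
      using rank_matrix_word_ge[of "\<lambda>t. e t ** e t" "sorted_list_of_set S"] finS
      by (simp add: rank_0_gen sum_list_distinct_conv_sum_set)
    also have "\<dots> \<le> card S * d"
      using sum_bounded_above[of S "\<lambda>t. CARD('n) - rank (e t ** e t)" d] deficiency S F by force
    finally show False using small[OF S] by simp
  qed
  then have "card F \<le> CARD('n \<times> 'n)"
    using anticommuting_monomials_independent[OF anti F parity]
    by (intro card_le_CARD_if_scalars_zero[OF fin, of "flatten \<circ> monomial e"])
      (simp add: sum_scale_flatten flatten_eq_0_iff)
  then show ?thesis by (simp add: power2_eq_square)
qed

section \<open>Bounds on the size of the family\<close>

lemma anticommuting_binomial_le:
  fixes e :: "nat \<Rightarrow> complex^'n^'n"
  assumes anti: "anticommuting k e"
    and deficiency: "\<And>i. i < k \<Longrightarrow> CARD('n) \<le> rank (e i ** e i) + d"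
    and small: "c * d < CARD('n)"
  shows "k choose c \<le> CARD('n) ^ 2"
proof -
  have "card {S. S \<subseteq> {..<k} \<and> card S = c} \<le> CARD('n) ^ 2"
    by (rule card_anticommuting_family_le[OF anti _ _ deficiency, of _ c]) (use small in auto)
  then show ?thesis by (simp add: n_subsets)
qed

lemma anticommuting_two_power_le:
  fixes e :: "nat \<Rightarrow> complex^'n^'n"
  assumes anti: "anticommuting k e"
    and deficiency: "\<And>i. i < k \<Longrightarrow> CARD('n) \<le> rank (e i ** e i) + d"
    and "m \<le> k" and small: "m * d < CARD('n)"
  shows "2 ^ m \<le> 2 * CARD('n) ^ 2"
proof -
  let ?subsets_of_parity = "\<lambda>p::nat. {S\<in>Pow {..<m}. even (card S) = even p}"
  have bound: "card (?subsets_of_parity p) \<le> CARD('n) ^ 2" for p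
  proof (rule card_anticommuting_family_le[OF anti _ _ deficiency, where p = p])
    show "?subsets_of_parity p \<subseteq> Pow {..<k}" using \<open>m \<le> k\<close> by auto
    fix S assume "S \<in> ?subsets_of_parity p"
    then have "card S \<le> m" using card_mono[of "{..<m}" S] by simp
    then show "card S * d < CARD('n)" using small by (meson le_less_trans mult_le_mono1)
  qed simp
  have "(2::nat) ^ m = card (Pow {..<m})" by (simp add: card_Pow)
  also have "\<dots> = card (?subsets_of_parity 0 \<union> ?subsets_of_parity 1)"
    by (rule arg_cong[where f = card]) auto
  also have "\<dots> \<le> card (?subsets_of_parity 0) + card (?subsets_of_parity 1)"
    by (rule card_Un_le)
  also have "\<dots> \<le> 2 * CARD('n) ^ 2" using bound[of 0] bound[of 1] by simp
  finally show ?thesis .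
qed

lemma mult_deficiency_less:
  fixes n r :: nat and x :: real
  assumes n: "0 < n" and x: "0 < x" and r: "real n * (1 - 1 / x) < real r"
  shows "x * real (n - r) < real n"
proof (cases "r \<le> n")
  case True
  have "real n - real r < real n / x" using r by (simp add: right_diff_distrib)
  then show ?thesis using x True by (simp add: field_simps of_nat_diff)
qed (use n in simp)

lemma le_mult_root_if_binomial_le:
  fixes k c :: nat and N :: real
  assumes c: "0 < c" and N: "1 \<le> N" and binomial: "real (k choose c) \<le> N"
  shows "real k \<le> real c * N powr (1 / real c)"
proof (cases "c \<le> k")
  case True
  have "(real k / real c) ^ c \<le> N"
    using binomial_ge_n_over_k_pow_k[OF True, where 'a = real] binomial by linarith
  also have "N = (N powr (1 / real c)) powr real c"
    using c N by (simp add: powr_powr)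
  also have "\<dots> = (N powr (1 / real c)) ^ c"
    using N by (simp add: powr_realpow)
  finally have "(real k / real c) ^ Suc (c - 1) \<le> (N powr (1 / real c)) ^ Suc (c - 1)"
    using c by simp
  then have "real k / real c \<le> N powr (1 / real c)"
    by (rule power_le_imp_le_base) simp
  then show ?thesis using c by (simp add: field_simps)
next
  case False
  have "1 \<le> N powr (1 / real c)" using N by (simp add: ge_one_powr_ge_zero)
  then have "real c * 1 \<le> real c * N powr (1 / real c)" by (rule mult_left_mono) simp
  with False show ?thesis by linarith
qed

lemma le_two_log_if_two_power_le:
  fixes m n :: nat
  assumes n: "0 < n" and two_power: "2 ^ m \<le> 2 * n ^ 2"
  shows "real m \<le> 2 * log 2 (real n) + 1"
proof -
  have "real (2 ^ m) \<le> real (2 * n ^ 2)" using two_power by (simp only: of_nat_le_iff)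
  then have "(2::real) ^ m \<le> 2 * real n ^ 2" by simp
  then have "log 2 (2 ^ m) \<le> log 2 (2 * real n ^ 2)"
    using n by (subst log_le_cancel_iff) auto
  moreover have "log 2 ((2::real) ^ m) = real m" by (simp add: log_nat_power)
  moreover have "log 2 (2 * real n ^ 2) = 2 * log 2 (real n) + 1"
    using n by (simp add: log_mult log_nat_power)
  ultimately show ?thesis by simp
qed

lemma anticommuting_card_le_root:
  fixes e :: "nat \<Rightarrow> complex^'n^'n"
  assumes anti: "anticommuting k e"
    and deficiency: "\<And>i. i < k \<Longrightarrow> CARD('n) \<le> rank (e i ** e i) + d"
    and c: "0 < c" and small: "real c * real d < real CARD('n)"
  shows "real k \<le> real c * real CARD('n) powr (2 / real c)"
proof -
  have "c * d < CARD('n)" using small by (simp flip: of_nat_mult)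
  then have "k choose c \<le> CARD('n) ^ 2" using anticommuting_binomial_le[OF anti deficiency] by blast
  then have "real k \<le> real c * (real CARD('n) ^ 2) powr (1 / real c)"
    using c by (intro le_mult_root_if_binomial_le) (auto simp flip: of_nat_power)
  also have "(real CARD('n) ^ 2) powr (1 / real c) = (real CARD('n) powr 2) powr (1 / real c)"
    by simp
  also have "\<dots> = real CARD('n) powr (2 / real c)" unfolding powr_powr by simp
  finally show ?thesis .
qed

lemma anticommuting_card_le_log:
  fixes e :: "nat \<Rightarrow> complex^'n^'n"
  assumes anti: "anticommuting k e"
    and deficiency: "\<And>i. i < k \<Longrightarrow> CARD('n) \<le> rank (e i ** e i) + d"
    and small: "2 * (log 2 (real CARD('n)) + 1) * real d < real CARD('n)"
  shows "real k \<le> 2 * log 2 (real CARD('n)) + 1"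
proof -
  let ?L = "log 2 (real CARD('n))"
  define M where "M = nat \<lfloor>2 * ?L + 2\<rfloor>"
  have "0 \<le> ?L" by simp
  then have M: "2 * ?L + 1 < real M" "real M \<le> 2 * (?L + 1)"
    unfolding M_def using of_int_floor_le[of "2 * ?L + 2"] by (linarith, simp add: of_nat_nat)
  define m where "m = min k M"
  have "real m * real d \<le> 2 * (?L + 1) * real d"
    using M(2) by (intro mult_right_mono) (auto simp: m_def)
  then have "m * d < CARD('n)" using small by (simp flip: of_nat_mult)
  then have "2 ^ m \<le> 2 * CARD('n) ^ 2"
    using anticommuting_two_power_le[OF anti deficiency] by (simp add: m_def)
  then have m: "real m \<le> 2 * ?L + 1" by (rule le_two_log_if_two_power_le[rotated]) simp
  with M(1) have "m = k" unfolding m_def by (cases "k \<le> M") auto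
  with m show ?thesis by simp
qed

theorem theorem4p3:
  fixes e :: "nat \<Rightarrow> complex^'n^'n" and k :: nat
  defines "n \<equiv> CARD('n)"
  defines "r \<equiv> Min ((\<lambda>i. rank (e i ** e i)) ` {..<k})"
  assumes anti: "anticommuting k e"
  shows "(\<forall>c::nat. c > 0 \<longrightarrow> real r > real n * (1 - 1 / real c)
            \<longrightarrow> real k \<le> real c * real n powr (2 / real c))
       \<and> (real r > real n * (1 - 1 / (2 * (log 2 (real n) + 1)))
            \<longrightarrow> real k \<le> 2 * log 2 (real n) + 1)"
proof -
  have n: "0 < n" unfolding n_def by simp
  have deficiency: "CARD('n) \<le> rank (e i ** e i) + (n - r)" if "i < k" for i
  proof -
    have "r \<le> rank (e i ** e i)" unfolding r_def using that by (intro Min_le) auto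
    then show ?thesis unfolding n_def by linarith
  qed
  show ?thesis
  proof (intro conjI allI impI)
    fix c :: nat assume c: "0 < c" and "real n * (1 - 1 / real c) < real r"
    with mult_deficiency_less[OF n] have "real c * real (n - r) < real n" by simp
    with anticommuting_card_le_root[OF anti _ c, of "n - r"] deficiency
    show "real k \<le> real c * real n powr (2 / real c)" unfolding n_def by blast
  next
    assume r: "real n * (1 - 1 / (2 * (log 2 (real n) + 1))) < real r"
    have "0 \<le> log 2 (real n)" using n by simp
    then have "0 < 2 * (log 2 (real n) + 1)" by simp
    from mult_deficiency_less[OF n this r]
    have "2 * (log 2 (real n) + 1) * real (n - r) < real n" .
    with anticommuting_card_le_log[OF anti, of "n - r"] deficiency
    show "real k \<le> 2 * log 2 (real n) + 1" unfolding n_def by blast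
  qed
qed

end
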